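(* Consider the virtual-inertia auction defined in the context, with allocation function $\mu^{\mathrm{VCG}}$ in terms of the bids and payment function $p^{\mathrm{VCG}}$. Then for every agent $k\in\mathcal{A}$: (i) the VCG mechanism is incentive-compatible, i.e. agent $k$ maximizes its utility by bidding its true cost: $$u_k(c_k,b_{-k})\ \ge\ u_k(b_k,b_{-k})\qquad\text{for all } b_{-k},\,b_k;$$ (ii) the utilities of the agents and the payments made to the agents are non-negative, i.e. $u_k\ge 0$ and $p_k^{\mathrm{VCG}}\ge 0$; (iii) the allocation $\mu^{\mathrm{VCG}}(c)$, where $c=(c_k)_{k\in\mathcal{A}}$ is the profile of true costs, is efficient, i.e. it solves the social welfare maximization (centralized planning) problem $$\min_{\mu}\ \ \gamma\,\Gamma(m(\mu))+\sum_{k\in\mathcal{A}}c_k(\mu_k)\qquad\text{subject to}\qquad 0\le\mu_k\le\overline{\mu}_k\quad\text{for all }k\in\mathcal{A}.$$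
   Context: **Network and agents.** There are $n$ nodes $i\in\{1,\dots,n\}$. Node $i$ has existing (residual) inertia $m_i^0$. The set of agents is $\mathcal{A}=\mathcal{A}_1\cup\dots\cup\mathcal{A}_n$, where $\mathcal{A}_i$ is the set of agents at node $i$. Agent $k$ can provide an amount $\mu_k$ of virtual inertia, up to a capacity $\overline{\mu}_k$. The feasible set of allocations is $$\mathcal{M}=\{\mu:\ 0\le\mu_k\le\overline{\mu}_k\ \text{for all }k\in\mathcal{A}\}.$$ An allocation $\mu$ produces the inertia vector $m(\mu)\in\mathbb{R}^n$ with $$m_i(\mu)=m_i^0+\sum_{k\in\mathcal{A}_i}\mu_k ,$$ and all nodal inertias $m_i$ are positive. **Worst-case performance metric.** Let $\pi_{\mathrm{tot}}$ be a given disturbance budget and let $\mathcal{P}=\{\pi\in\mathbb{R}^n:\ \pi_i\ge 0\ \text{for all }i,\ \sum_{i=1}^n\pi_i\le\pi_{\mathrm{tot}}\}$ be the set of disturbance strengths. For $m\in\mathbb{R}^n$ with all $m_i>0$, put $$\Gamma(m)=\max_{\pi\in\mathcal{P}}\ \sum_{i=1}^n\frac{\pi_i}{m_i}.$$ Here $\sum_i \pi_i/m_i$ is the squared $\mathcal{H}_2$ norm (primary control effort) of the linearized power network. Fix a trade-off parameter $\gamma>0$. **Costs and bids.** Each agent $k$ has a private cost function $c_k(\mu_k)$, which is convex and non-decreasing. Each agent submits a bidding curve $b_k(\mu_k)$, which is convex and non-decreasing with $b_k(0)=0$. The mechanism is direct: the bids are the same type of functions as the costs. A bid profile is $b=(b_k)_{k\in\mathcal{A}}$,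 also written $b=(b_k,b_{-k})$, where $b_{-k}$ collects the bids of all agents other than $k$. **Allocation rule.** For a bid profile $b$ let $$\mathcal{B}(\mu,b)=\gamma\,\Gamma(m(\mu))+\sum_{k\in\mathcal{A}}b_k(\mu_k),\qquad \mu^{\mathrm{VCG}}(b)=\arg\min_{\mu\in\mathcal{M}}\mathcal{B}(\mu,b),$$ the optimal allocation being taken to be unique. For each agent $k$, let $\mathcal{M}_{-k}=\{\mu\in\mathcal{M}:\mu_k=0\}$ and $$\mu^{\mathrm{VCG}\text{-}k}(b)=\arg\min_{\mu\in\mathcal{M}_{-k}}\mathcal{B}(\mu,b),$$ the optimal allocation when agent $k$ abstains from the auction. **VCG payment rule.** The payment to agent $k$ is $$p_k^{\mathrm{VCG}}(b)=\mathcal{B}\big(\mu^{\mathrm{VCG}\text{-}k}(b),b\big)-\Big(\mathcal{B}\big(\mu^{\mathrm{VCG}}(b),b\big)-b_k\big(\mu_k^{\mathrm{VCG}}(b)\big)\Big).$$ **Utility.** The utility of agent $k$ is $u_k(b_k,b_{-k})=p_k^{\mathrm{VCG}}(b_k,b_{-k})-c_k\big(\mu_k^{\mathrm{VCG}}(b_k,b_{-k})\big)$.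
   Formalization: Non-negativity of the utilities in (ii) is stated for an agent bidding its true cost (any bids of the others), since it fails for untruthful bids such as a zero bid with a high cost; costs, like bids, are convex and non-decreasing on [0,∞) with c_k(0)=0. *)

theory Defs
  imports "HOL-Analysis.Analysis"
begin

text \<open>
  Nodes are the elements of the finite type \<open>'n\<close> and agents those of the finite type \<open>'k\<close>.
  Inertia vectors, disturbance strengths and allocations are vectors indexed by these types.
\<close>

record ('n :: finite, 'k :: finite) inertia_market =
  agents_at :: "'n \<Rightarrow> 'k set"
  residual_inertia :: "real ^ 'n"
  capacity :: "real ^ 'k"
  disturbance_budget :: real
  tradeoff :: real

type_synonym 'k profile = "'k \<Rightarrow> real \<Rightarrow> real"

definition feasible :: "('n :: finite, 'k :: finite) inertia_market \<Rightarrow> (real ^ 'k) set" where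
  "feasible G = {\<mu>. \<forall>k. 0 \<le> \<mu> $ k \<and> \<mu> $ k \<le> capacity G $ k}"

definition feasible_without ::
  "('n :: finite, 'k :: finite) inertia_market \<Rightarrow> 'k \<Rightarrow> (real ^ 'k) set" where
  "feasible_without G k = {\<mu> \<in> feasible G. \<mu> $ k = 0}"

definition inertia :: "('n :: finite, 'k :: finite) inertia_market \<Rightarrow> real ^ 'k \<Rightarrow> real ^ 'n" where
  "inertia G \<mu> = (\<chi> i. residual_inertia G $ i + (\<Sum>k\<in>agents_at G i. \<mu> $ k))"

definition disturbances :: "('n :: finite, 'k :: finite) inertia_market \<Rightarrow> (real ^ 'n) set" where
  "disturbances G = {\<pi>. (\<forall>i. 0 \<le> \<pi> $ i) \<and> (\<Sum>i\<in>UNIV. \<pi> $ i) \<le> disturbance_budget G}"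

text \<open>
  The worst case is a maximum of a linear function over an infinite set, hence \<open>SUP\<close> and not
  \<open>Max\<close>.  It is attained because the set of disturbances is compact, and nonempty for a
  nonnegative budget.
\<close>

definition worst_case :: "('n :: finite, 'k :: finite) inertia_market \<Rightarrow> real ^ 'n \<Rightarrow> real" where
  "worst_case G m = (SUP \<pi>\<in>disturbances G. \<Sum>i\<in>UNIV. \<pi> $ i / m $ i)"

definition market :: "('n :: finite, 'k :: finite) inertia_market \<Rightarrow> bool" where
  "market G \<longleftrightarrow>
     (\<Union>i. agents_at G i) = UNIV \<and>
     (\<forall>k. 0 \<le> capacity G $ k) \<and>
     (\<forall>\<mu>\<in>feasible G. \<forall>i. 0 < inertia G \<mu> $ i) \<and>
     0 \<le> disturbance_budget G \<and>
     0 < tradeoff G"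

text \<open>
  The mechanism is direct, so this is the class of both bids and costs.  The normalisation at
  \<open>0\<close> is therefore imposed on costs as well: otherwise a true cost is not a legal bid.
\<close>

definition bid_curve :: "(real \<Rightarrow> real) \<Rightarrow> bool" where
  "bid_curve f \<longleftrightarrow> convex_on {0..} f \<and> mono_on {0..} f \<and> f 0 = 0"

definition objective ::
  "('n :: finite, 'k :: finite) inertia_market \<Rightarrow> 'k profile \<Rightarrow> real ^ 'k \<Rightarrow> real" where
  "objective G b \<mu> = tradeoff G * worst_case G (inertia G \<mu>) + (\<Sum>k\<in>UNIV. b k (\<mu> $ k))"

text \<open>
  If the minimiser is unique, \<open>arg_min_on\<close> is that minimiser; if it is not, \<open>arg_min_on\<close> chooses
  one.  Uniqueness is not a requirement on the profile: for convex curves on \<open>{0..}\<close> it fails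
  already for two agents at one node with the same linear bid.
\<close>

definition vcg_allocation ::
  "('n :: finite, 'k :: finite) inertia_market \<Rightarrow> 'k profile \<Rightarrow> real ^ 'k" where
  "vcg_allocation G b = arg_min_on (objective G b) (feasible G)"

definition vcg_allocation_without ::
  "('n :: finite, 'k :: finite) inertia_market \<Rightarrow> 'k \<Rightarrow> 'k profile \<Rightarrow> real ^ 'k" where
  "vcg_allocation_without G k b = arg_min_on (objective G b) (feasible_without G k)"

definition vcg_payment ::
  "('n :: finite, 'k :: finite) inertia_market \<Rightarrow> 'k \<Rightarrow> 'k profile \<Rightarrow> real" where
  "vcg_payment G k b =
     objective G b (vcg_allocation_without G k b)
       - (objective G b (vcg_allocation G b) - b k (vcg_allocation G b $ k))"

text \<open>The profile \<open>c\<close> holds the private costs and \<open>b\<close> the submitted bids.\<close>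

definition utility ::
  "('n :: finite, 'k :: finite) inertia_market \<Rightarrow> 'k profile \<Rightarrow> 'k \<Rightarrow> 'k profile \<Rightarrow> real" where
  "utility G c k b = vcg_payment G k b - c k (vcg_allocation G b $ k)"

end

theory Submission
  imports Defs
begin

text \<open>
  The idea behind the claims on incentives is that the payment to an agent equals the optimal cost of the
  market without that agent minus the cost that the bids of all others attribute to the chosen
  allocation.  The first term is beyond the influence of agent \<open>k\<close>: an allocation that gives
  nothing to \<open>k\<close> costs the same under every bid of \<open>k\<close>, since bids vanish at \<open>0\<close>.  The second term,
  together with the true cost of \<open>k\<close>, is the objective of the profile in which \<open>k\<close> bids
  truthfully, evaluated at the chosen allocation (\<open>utility_eq\<close>).  A truthful bid makes the
  mechanism minimise exactly this quantity, which gives incentive compatibility; and the minimum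
  over all allocations is at most the minimum over those that exclude \<open>k\<close>, which gives
  truthful agents a non-negative utility.

  Non-negativity of the payment for an arbitrary bid uses the physics: more inertia anywhere never
  increases the worst case.  Giving agent \<open>k\<close> its awarded amount on top of the optimal allocation
  without \<open>k\<close> therefore does not raise the metric, and it adds only the bid of \<open>k\<close> itself to the cost
  (\<open>vcg_payment_nonneg\<close>).

  All of this presupposes that the minima are attained; efficiency is nothing but this, applied to
  the profile of true costs.  The worst-case metric has the closed form
  budget over smallest nodal inertia, which is continuous as long as inertias are positive, and a
  convex non-decreasing curve on \<open>{0..}\<close> is continuous even at the boundary point \<open>0\<close>.  So the
  objective is continuous on a compact box.
\<close>

section \<open>Continuity of bid curves\<close>

text \<open>
  Convexity gives continuity in the interior.  At the boundary point \<open>0\<close> convexity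
  alone would still allow a value above the limit from the right.  Monotonicity rules this out:
  it gives \<open>0 \<le> f x\<close>, and together with the chord bound \<open>f x \<le> x * f 1\<close> this squeezes the
  curve.
\<close>

lemma bid_curve_continuous:
  assumes "bid_curve f"
  shows "continuous_on {0..} f"
proof -
  have conv: "convex_on {0..} f" and mono: "mono_on {0..} f" and zero: "f 0 = 0"
    using assms by (auto simp: bid_curve_def)
  have "continuous_on {0<..} f"
  proof (rule convex_on_continuous)
    show "convex_on {0<..} f"
      by (rule convex_on_subset[OF conv]) auto
  qed simp
  then have "continuous (at x) f" if "0 < x" for x
    using that by (simp add: continuous_on_eq_continuous_at)
  then have interior: "continuous (at x within {0..}) f" if "0 < x" for x
    using that continuous_at_imp_continuous_at_within by blast
  have lower: "0 \<le> f x" if "0 \<le> x" for x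
    using monotone_onD[OF mono, of 0 x] that zero by simp
  have upper: "f x \<le> x * f 1" if "0 \<le> x" "x \<le> 1" for x
    using convex_onD[OF conv, of x 0 1] that zero by simp
  have "(f \<longlongrightarrow> 0) (at 0 within {0..})"
  proof (rule tendsto_sandwich)
    show "\<forall>\<^sub>F x in at 0 within {0..}. 0 \<le> f x"
      by (auto simp: eventually_at_filter lower)
    show "\<forall>\<^sub>F x in at 0 within {0..}. f x \<le> x * f 1"
      unfolding eventually_at by (rule exI[of _ 1]) (auto simp: upper dist_real_def)
    show "((\<lambda>x. x * f 1) \<longlongrightarrow> 0) (at 0 within {0..})"
      by (auto intro!: tendsto_eq_intros)
  qed simp
  then have boundary: "continuous (at 0 within {0..}) f"
    by (simp add: continuous_within zero)
  show ?thesis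
    unfolding continuous_on_eq_continuous_within
  proof
    fix x :: real
    assume "x \<in> {0..}"
    then show "continuous (at x within {0..}) f"
      using interior boundary by (cases "x = 0") auto
  qed
qed

section \<open>The worst-case metric\<close>

text \<open>
  A linear function on the simplex of disturbances is largest at a vertex: the adversary spends
  the whole budget at a node of smallest inertia.
\<close>

lemma worst_case_eq:
  assumes budget: "0 \<le> disturbance_budget G" and pos: "\<And>i. 0 < m $ i"
  shows "worst_case G m = disturbance_budget G / Min (range (($) m))"
proof -
  let ?M = "Min (range (($) m))"
  have "?M \<in> range (($) m)"
    by (rule Min_in) auto
  then obtain i where i: "m $ i = ?M"
    by (metis imageE)
  have M: "0 < ?M"
    using pos[of i] i by simp
  have bound: "(\<Sum>j\<in>UNIV. \<pi> $ j / m $ j) \<le> disturbance_budget G / ?M"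
    if "\<pi> \<in> disturbances G" for \<pi>
  proof -
    have "(\<Sum>j\<in>UNIV. \<pi> $ j / m $ j) \<le> (\<Sum>j\<in>UNIV. \<pi> $ j / ?M)"
      using that M by (intro sum_mono divide_left_mono)
        (auto simp: disturbances_def intro!: mult_pos_pos pos)
    also have "\<dots> \<le> disturbance_budget G / ?M"
      unfolding sum_divide_distrib[symmetric] using that M
      by (intro divide_right_mono) (auto simp: disturbances_def intro: less_imp_le)
    finally show ?thesis .
  qed
  let ?\<pi> = "axis i (disturbance_budget G)"
  have vertex: "?\<pi> \<in> disturbances G"
    using budget by (auto simp: disturbances_def axis_def)
  have "(\<Sum>j\<in>UNIV. ?\<pi> $ j / m $ j) = (\<Sum>j\<in>UNIV. if j = i then disturbance_budget G / ?M else 0)"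
    by (intro sum.cong) (auto simp: axis_def i)
  also have "\<dots> = disturbance_budget G / ?M"
    by (rule trans[OF sum.delta]) auto
  finally have attained: "disturbance_budget G / ?M = (\<Sum>j\<in>UNIV. ?\<pi> $ j / m $ j)" ..
  show ?thesis
    unfolding worst_case_def
  proof (rule cSup_eq_maximum)
    show "disturbance_budget G / ?M \<in> (\<lambda>\<pi>. \<Sum>j\<in>UNIV. \<pi> $ j / m $ j) ` disturbances G"
      using attained vertex by (rule image_eqI)
  qed (use bound in blast)
qed

lemma worst_case_antimono:
  assumes "0 \<le> disturbance_budget G" and pos: "\<And>i. 0 < m $ i" and le: "\<And>i. m $ i \<le> m' $ i"
  shows "worst_case G m' \<le> worst_case G m"
proof -
  have pos': "0 < m' $ i" for i
    using pos[of i] le[of i] by linarith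
  have "Min (range (($) m)) \<le> m' $ i" for i
    by (rule order_trans[OF Min_le le]) auto
  then have "Min (range (($) m)) \<le> Min (range (($) m'))"
    by simp
  moreover have "0 < Min (range (($) m))" "0 < Min (range (($) m'))"
    using pos pos' by simp_all
  ultimately show ?thesis
    using assms pos' by (simp add: worst_case_eq divide_left_mono)
qed

lemma continuous_on_Min_image:
  fixes f :: "'i \<Rightarrow> 'a :: topological_space \<Rightarrow> 'b :: linorder_topology"
  assumes "finite I" "I \<noteq> {}" "\<And>i. i \<in> I \<Longrightarrow> continuous_on S (f i)"
  shows "continuous_on S (\<lambda>x. Min ((\<lambda>i. f i x) ` I))"
  using assms by (induction I rule: finite_ne_induct) (auto intro: continuous_on_min)

section \<open>Existence of optimal allocations\<close>

lemma continuous_on_objective: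
  assumes "market G" and "\<And>j. bid_curve (b j)"
  shows "continuous_on (feasible G) (objective G b)"
proof -
  have inertia: "continuous_on (feasible G) (\<lambda>\<mu>. inertia G \<mu> $ i)" for i
    by (simp add: inertia_def) (intro continuous_intros)
  have pos: "0 < inertia G \<mu> $ i" if "\<mu> \<in> feasible G" for \<mu> i
    using assms that by (auto simp: market_def)
  have "continuous_on (feasible G)
      (\<lambda>\<mu>. disturbance_budget G / Min (range (($) (inertia G \<mu>))))"
  proof (intro continuous_on_divide continuous_on_const)
    show "continuous_on (feasible G) (\<lambda>\<mu>. Min (range (($) (inertia G \<mu>))))"
      by (rule continuous_on_Min_image) (auto simp: inertia)
    have "0 < Min (range (($) (inertia G \<mu>)))" if "\<mu> \<in> feasible G" for \<mu>
      using pos that by simp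
    then show "\<forall>\<mu>\<in>feasible G. Min (range (($) (inertia G \<mu>))) \<noteq> 0"
      by (metis less_irrefl)
  qed
  then have metric: "continuous_on (feasible G) (\<lambda>\<mu>. worst_case G (inertia G \<mu>))"
    using assms pos by (subst continuous_on_cong[OF refl worst_case_eq]) (auto simp: market_def)
  have bid: "continuous_on (feasible G) (\<lambda>\<mu>. b j (\<mu> $ j))" for j
    using bid_curve_continuous[OF assms(2)[of j]]
    by (rule continuous_on_compose2) (auto simp: feasible_def intro!: continuous_intros)
  show ?thesis
    unfolding objective_def by (intro continuous_intros metric bid)
qed

lemma compact_feasible: "compact (feasible G)"
proof -
  have "feasible G = cbox 0 (capacity G)"
    by (auto simp: feasible_def mem_box_cart)
  then show ?thesis
    by simp
qed

lemma compact_feasible_without: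
  fixes k :: "'k :: finite"
  shows "compact (feasible_without G k)"
proof -
  have "feasible_without G k = feasible G \<inter> {\<mu>. \<mu> $ k = 0}"
    by (auto simp: feasible_without_def)
  moreover have "closed {\<mu> :: real ^ 'k. \<mu> $ k = 0}"
    by (intro closed_Collect_eq continuous_intros)
  ultimately show ?thesis
    by (simp add: compact_Int_closed compact_feasible)
qed

lemma zero_feasible_without:
  assumes "market G"
  shows "0 \<in> feasible_without G k"
  using assms by (simp add: feasible_without_def feasible_def market_def)

lemma is_arg_min_arg_min_on:
  fixes f :: "'a :: topological_space \<Rightarrow> 'b :: linorder_topology"
  assumes "compact S" "S \<noteq> {}" "continuous_on S f"
  shows "is_arg_min f (\<lambda>x. x \<in> S) (arg_min_on f S)"
proof -
  obtain x where "x \<in> S" "\<forall>y\<in>S. f x \<le> f y"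
    using continuous_attains_inf[OF assms] by blast
  then have "is_arg_min f (\<lambda>x. x \<in> S) x"
    by (simp add: is_arg_min_linorder)
  then show ?thesis
    unfolding arg_min_on_def arg_min_def by (rule someI)
qed

lemma is_arg_min_vcg_allocation:
  assumes "market G" and "\<And>j. bid_curve (b j)"
  shows "is_arg_min (objective G b) (\<lambda>\<mu>. \<mu> \<in> feasible G) (vcg_allocation G b)"
  unfolding vcg_allocation_def
  using zero_feasible_without[OF assms(1)] continuous_on_objective[OF assms]
  by (intro is_arg_min_arg_min_on compact_feasible) (auto simp: feasible_without_def)

lemma is_arg_min_vcg_allocation_without:
  assumes "market G" and "\<And>j. bid_curve (b j)"
  shows "is_arg_min (objective G b) (\<lambda>\<mu>. \<mu> \<in> feasible_without G k)
    (vcg_allocation_without G k b)"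
  unfolding vcg_allocation_without_def
proof (intro is_arg_min_arg_min_on compact_feasible_without)
  show "continuous_on (feasible_without G k) (objective G b)"
    using continuous_on_objective[OF assms]
    by (rule continuous_on_subset) (auto simp: feasible_without_def)
qed (use zero_feasible_without[OF assms(1)] in blast)

section \<open>Incentives\<close>

lemma objective_fun_upd:
  "objective G (b(k := f)) \<mu> = objective G b \<mu> - b k (\<mu> $ k) + f (\<mu> $ k)"
proof -
  have "(\<Sum>j\<in>UNIV. (b(k := f)) j (\<mu> $ j)) = f (\<mu> $ k) + (\<Sum>j\<in>UNIV - {k}. b j (\<mu> $ j))"
    by (subst sum.remove[of _ k]) (auto intro!: sum.cong)
  moreover have "(\<Sum>j\<in>UNIV. b j (\<mu> $ j)) = b k (\<mu> $ k) + (\<Sum>j\<in>UNIV - {k}. b j (\<mu> $ j))"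
    by (rule sum.remove) auto
  ultimately show ?thesis
    by (simp add: objective_def)
qed

text \<open>
  Bids vanish at \<open>0\<close>, so changing the bid of \<open>k\<close> does not change the problem without \<open>k\<close> at all,
  not even which of several optimal allocations is chosen.
\<close>

lemma vcg_allocation_without_fun_upd:
  assumes "f 0 = 0" "b k 0 = 0"
  shows "vcg_allocation_without G k (b(k := f)) = vcg_allocation_without G k b"
proof -
  have "objective G (b(k := f)) \<mu> = objective G b \<mu>" if "\<mu> \<in> feasible_without G k" for \<mu>
    using that assms by (simp add: objective_fun_upd feasible_without_def)
  then have "is_arg_min (objective G (b(k := f))) (\<lambda>\<mu>. \<mu> \<in> feasible_without G k)
      = is_arg_min (objective G b) (\<lambda>\<mu>. \<mu> \<in> feasible_without G k)"
    by (auto simp: is_arg_min_def fun_eq_iff)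
  then show ?thesis
    by (simp add: vcg_allocation_without_def arg_min_on_def arg_min_def)
qed

text \<open>
  The alignment of interests behind the mechanism: up to a term that agent \<open>k\<close> cannot influence,
  its utility is the negative of the objective with its true cost in place of its bid.
\<close>

lemma utility_eq:
  "utility G c k b = objective G b (vcg_allocation_without G k b)
     - objective G (b(k := c k)) (vcg_allocation G b)"
  by (simp add: utility_def vcg_payment_def objective_fun_upd)

lemma truthful_bid_maximizes_utility:
  assumes "market G" and b: "\<And>j. bid_curve (b j)" and b': "bid_curve b'" and c: "bid_curve (c k)"
  shows "utility G c k (b(k := b')) \<le> utility G c k (b(k := c k))"
proof -
  let ?c = "b(k := c k)" and ?b = "b(k := b')"
  have curves: "\<And>j. bid_curve (?c j)" "\<And>j. bid_curve (?b j)"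
    using assms by auto
  let ?\<nu> = "vcg_allocation_without G k b"
  have \<nu>: "vcg_allocation_without G k ?c = ?\<nu>" "vcg_allocation_without G k ?b = ?\<nu>"
    using b b' c by (auto intro!: vcg_allocation_without_fun_upd simp: bid_curve_def)
  have "?\<nu> \<in> feasible_without G k"
    using is_arg_min_vcg_allocation_without[of G b k] assms by (simp add: is_arg_min_def)
  then have indep: "objective G ?c ?\<nu> = objective G ?b ?\<nu>"
    using b' c by (simp add: objective_fun_upd feasible_without_def bid_curve_def)
  have "vcg_allocation G ?b \<in> feasible G"
    using is_arg_min_vcg_allocation[of G ?b] assms(1) curves(2) by (simp add: is_arg_min_def)
  then have "objective G ?c (vcg_allocation G ?c) \<le> objective G ?c (vcg_allocation G ?b)"
    using is_arg_min_vcg_allocation[of G ?c] assms(1) curves(1) by (simp add: is_arg_min_linorder)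
  then show ?thesis
    unfolding utility_eq \<nu> indep by simp
qed

lemma truthful_utility_nonneg:
  assumes "market G" and b: "\<And>j. bid_curve (b j)" and c: "bid_curve (c k)"
  shows "0 \<le> utility G c k (b(k := c k))"
proof -
  let ?c = "b(k := c k)"
  have curves: "\<And>j. bid_curve (?c j)"
    using assms by auto
  have "vcg_allocation_without G k ?c \<in> feasible G"
    using is_arg_min_vcg_allocation_without[of G ?c k] assms(1) curves
    by (simp add: is_arg_min_def feasible_without_def)
  then show ?thesis
    using is_arg_min_vcg_allocation[of G ?c] assms(1) curves
    by (simp add: utility_eq is_arg_min_linorder)
qed

text \<open>
  Optimality of \<open>\<mu>\<close> is tested against the allocation \<open>\<nu>\<close> without \<open>k\<close>, amended by the award of \<open>k\<close>
  under \<open>\<mu>\<close>.  The bid of \<open>k\<close> is then the same on both sides and cancels, and restoring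
  \<open>\<nu> $ k = 0\<close> can only raise the worst case.
\<close>

lemma vcg_payment_nonneg:
  assumes "market G" and b: "\<And>j. bid_curve (b j)"
  shows "0 \<le> vcg_payment G k b"
proof -
  let ?\<mu> = "vcg_allocation G b" and ?\<nu> = "vcg_allocation_without G k b"
  define \<rho> where "\<rho> = (\<chi> j. if j = k then ?\<mu> $ k else ?\<nu> $ j)"
  have \<mu>: "?\<mu> \<in> feasible G" and opt: "\<And>\<mu>'. \<mu>' \<in> feasible G \<Longrightarrow> objective G b ?\<mu> \<le> objective G b \<mu>'"
    using is_arg_min_vcg_allocation[of G b] assms by (auto simp: is_arg_min_linorder)
  have \<nu>: "?\<nu> \<in> feasible G" "?\<nu> $ k = 0"
    using is_arg_min_vcg_allocation_without[of G b k] assms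
    by (auto simp: is_arg_min_def feasible_without_def)
  have \<rho>: "\<rho> \<in> feasible G" and le: "?\<nu> $ j \<le> \<rho> $ j" for j
    using \<mu> \<nu> by (auto simp: \<rho>_def feasible_def)
  have "worst_case G (inertia G \<rho>) \<le> worst_case G (inertia G ?\<nu>)"
  proof (rule worst_case_antimono)
    show "inertia G ?\<nu> $ i \<le> inertia G \<rho> $ i" for i
      by (simp add: inertia_def sum_mono le)
  qed (use assms(1) \<nu> in \<open>auto simp: market_def\<close>)
  then have metric:
      "tradeoff G * worst_case G (inertia G \<rho>) \<le> tradeoff G * worst_case G (inertia G ?\<nu>)"
    using assms(1) by (simp add: market_def)
  have "(\<Sum>j\<in>UNIV. b j (\<rho> $ j)) = b k (?\<mu> $ k) + (\<Sum>j\<in>UNIV - {k}. b j (?\<nu> $ j))"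
    by (subst sum.remove[of _ k]) (auto simp: \<rho>_def intro!: sum.cong)
  moreover have "(\<Sum>j\<in>UNIV. b j (?\<nu> $ j)) = (\<Sum>j\<in>UNIV - {k}. b j (?\<nu> $ j))"
    using b[of k] \<nu> by (subst sum.remove[of _ k]) (auto simp: bid_curve_def)
  ultimately have "objective G b \<rho> \<le> objective G b ?\<nu> + b k (?\<mu> $ k)"
    using metric by (simp add: objective_def)
  then show ?thesis
    using opt[OF \<rho>] by (simp add: vcg_payment_def)
qed

theorem theorem1:
  fixes G :: "('n :: finite, 'k :: finite) inertia_market" and c :: "'k profile"
  assumes "market G"
    and "\<forall>k. bid_curve (c k)"
  shows "(\<forall>k b b'. (\<forall>j. bid_curve (b j)) \<and> bid_curve b' \<longrightarrow>
            utility G c k (b(k := c k)) \<ge> utility G c k (b(k := b')))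
       \<and> (\<forall>k b. (\<forall>j. bid_curve (b j)) \<longrightarrow>
            utility G c k (b(k := c k)) \<ge> 0 \<and> vcg_payment G k b \<ge> 0)
       \<and> is_arg_min
            (\<lambda>\<mu>. tradeoff G * worst_case G (inertia G \<mu>) + (\<Sum>k\<in>UNIV. c k (\<mu> $ k)))
            (\<lambda>\<mu>. \<forall>k. 0 \<le> \<mu> $ k \<and> \<mu> $ k \<le> capacity G $ k)
            (vcg_allocation G c)"
proof (intro conjI allI impI)
  have "is_arg_min (objective G c) (\<lambda>\<mu>. \<mu> \<in> feasible G) (vcg_allocation G c)"
    using assms by (intro is_arg_min_vcg_allocation) auto
  then show "is_arg_min
            (\<lambda>\<mu>. tradeoff G * worst_case G (inertia G \<mu>) + (\<Sum>k\<in>UNIV. c k (\<mu> $ k)))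
            (\<lambda>\<mu>. \<forall>k. 0 \<le> \<mu> $ k \<and> \<mu> $ k \<le> capacity G $ k)
            (vcg_allocation G c)"
    by (simp add: objective_def[abs_def] feasible_def)
qed (use assms in \<open>auto intro: truthful_bid_maximizes_utility truthful_utility_nonneg
  vcg_payment_nonneg\<close>)

end
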